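(* Let $u$ be a (nonempty) packed word. Let $c_u(t)\in\mathbb{K}[t]$ be the polynomial defined by the expansion $$(e^{a_1}e^{a_2}e^{a_3}\cdots)^t=\sum_{u}c_u(t)\,\mathbf{M}_u(A),$$ the sum being over all packed words. Let $I$ be the composition recording the lengths of the maximal nondecreasing runs of $u$, let $J=(j_1,\dots,j_s)$ be the composition recording the lengths of the maximal blocks of consecutive identical letters of $u$, and set $r=\ell(I)$, $s=\ell(J)$. Then $$c_u(t)=\mathcal{F}_{s-r}\big(E^J(t)\big),$$ where $\mathcal{F}_{p}:\mathbb{K}[t]\to\mathbb{K}[t]$ is the linear map with $\mathcal{F}_p(t^k)=\binom{t+p}{k}$ and $$E^J(t)=\prod_{k=1}^{s}\frac{t\,E_{j_k}(t,t+1)}{j_k!},\qquad E_n(x,y)=\sum_{\sigma\in\mathfrak{S}_n}x^{d(\sigma)}y^{\,n-1-d(\sigma)},$$ with $d(\sigma)$ the number of descents of $\sigma$.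
   Context: $\mathbb{K}$ is a field of characteristic $0$. $A=\{a_1<a_2<\cdots\}$ is an infinite totally ordered alphabet of noncommuting variables; letters $a_i$ are also written $i$. For a word $w$ over $A$ whose distinct letters are $b_1<\dots<b_r$, $\mathrm{pack}(w)$ is the word obtained by replacing each $b_i$ by $i$; a word $u$ is packed if $\mathrm{pack}(u)=u$ (i.e. its set of letters is $\{1,\dots,r\}$ for some $r$). For a packed word $u$, $\mathbf{M}_u(A)=\sum_{\mathrm{pack}(w)=u}w$ (formal sum of words over $A$); thus $c_u(t)$ is the coefficient of any word $w$ with $\mathrm{pack}(w)=u$. The product $g=e^{a_1}e^{a_2}\cdots$ is a formal series of words in the noncommuting variables, with constant term $1$, and $g^t=\sum_{k\ge0}\binom{t}{k}(g-1)^k$, where $t$ is an indeterminate commuting with $A$ and $\binom{t+p}{k}=\frac{(t+p)(t+p-1)\cdots(t+p-k+1)}{k!}$. $\ell(I)$ denotes the number of parts of a composition $I$. The maximal nondecreasing runs of $u$ are the factors of the factorization $u=u_1\cdots u_r$ into nondecreasing words such that the last letter of each $u_i$ is strictly greater than the first letter of $u_{i+1}$. The maximal blocks of identical letters are given by writing $u=b_1^{j_1}b_2^{j_2}\cdots b_s^{j_s}$ with $b_i\ne b_{i+1}$. A descent of $\sigma\in\mathfrak{S}_n$ is an index $1\le i<n$ with $\sigma(i)>\sigma(i+1)$. *)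

theory Defs
  imports
    "HOL-Computational_Algebra.Polynomial"
    "HOL-Combinatorics.Permutations"
    "HOL-Library.Groups_Big_Fun"
begin

section \<open>Words and packing\<close>

text \<open>The letter \<open>a\<^sub>i\<close> is the natural number \<open>i \<ge> 1\<close>; a word over \<open>A\<close> is a list of positive
  natural numbers.\<close>

definition is_word :: "nat list \<Rightarrow> bool" where
  "is_word w \<longleftrightarrow> 0 \<notin> set w"

text \<open>The number of letters of \<open>w\<close> that are \<open>\<le> b\<^sub>i\<close> is \<open>i\<close>, if \<open>b\<^sub>1 < \<dots> < b\<^sub>r\<close> are the distinct
  letters of \<open>w\<close>.\<close>

definition pack :: "nat list \<Rightarrow> nat list" where
  "pack w = map (\<lambda>b. card {x \<in> set w. x \<le> b}) w"

definition packed :: "nat list \<Rightarrow> bool" where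
  "packed u \<longleftrightarrow> pack u = u"


section \<open>Noncommutative formal series\<close>

text \<open>A series is the function sending a word to its coefficient. All the series used here vanish
  on lists that contain the non-letter \<open>0\<close>.\<close>

type_synonym 'a series = "nat list \<Rightarrow> 'a"

definition ser_one :: "'a::comm_ring_1 series" where
  "ser_one w = (if w = [] then 1 else 0)"

definition ser_minus :: "'a::comm_ring_1 series \<Rightarrow> 'a series \<Rightarrow> 'a series" where
  "ser_minus F G w = F w - G w"

definition ser_mult :: "'a::comm_ring_1 series \<Rightarrow> 'a series \<Rightarrow> 'a series" where
  "ser_mult F G w = (\<Sum>i\<le>length w. F (take i w) * G (drop i w))"

primrec ser_power :: "'a::comm_ring_1 series \<Rightarrow> nat \<Rightarrow> 'a series" where
  "ser_power F 0 = ser_one"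
| "ser_power F (Suc k) = ser_mult F (ser_power F k)"

definition exp_letter :: "nat \<Rightarrow> 'k::field_char_0 series" where
  "exp_letter a w = (if \<exists>n. w = replicate n a then 1 / fact (length w) else 0)"

primrec exp_prod :: "nat \<Rightarrow> 'k::field_char_0 series" where
  "exp_prod 0 = ser_one"
| "exp_prod (Suc n) = ser_mult (exp_prod n) (exp_letter (Suc n))"

text \<open>The infinite product \<open>e^{a\<^sub>1} e^{a\<^sub>2} \<dots>\<close>: each coefficient of the finite products is
  eventually constant (lemma \<open>exp_prod_eventually\<close> below).\<close>

definition exp_prod_inf :: "'k::field_char_0 series" where
  "exp_prod_inf w = (THE c. eventually (\<lambda>n. exp_prod n w = c) sequentially)"

abbreviation poly_t :: "'k::field_char_0 poly" where
  "poly_t \<equiv> [:0, 1:]"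

definition poly_binomial :: "'k::field_char_0 poly \<Rightarrow> nat \<Rightarrow> 'k poly" where
  "poly_binomial f k = smult (1 / fact k) (\<Prod>i<k. f - of_nat i)"

lemma poly_poly_binomial: "poly (poly_binomial f k) x = poly f x gchoose k"
  by (simp add: poly_binomial_def gbinomial_prod_rev poly_prod atLeast0LessThan)

text \<open>\<open>g^t = \<Sum>k. (t choose k) (g - 1)^k\<close>; for each word this sum over \<open>k\<close> has finite support
  (lemma \<open>finite_support_ser_pow_t\<close> below).\<close>

definition ser_pow_t :: "'k::field_char_0 series \<Rightarrow> 'k poly series" where
  "ser_pow_t g w =
     Sum_any (\<lambda>k. smult (ser_power (ser_minus g ser_one) k w) (poly_binomial poly_t k))"

definition M_series :: "nat list \<Rightarrow> 'a::comm_ring_1 series" where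
  "M_series u w = (if is_word w \<and> pack w = u then 1 else 0)"

definition M_expansion :: "'a::comm_ring_1 series \<Rightarrow> (nat list \<Rightarrow> 'a) \<Rightarrow> bool" where
  "M_expansion G c \<longleftrightarrow> (\<forall>w. G w = Sum_any (\<lambda>u. if packed u then c u * M_series u w else 0))"


section \<open>Runs and blocks\<close>

definition nondecreasing_runs :: "nat list list \<Rightarrow> nat list \<Rightarrow> bool" where
  "nondecreasing_runs us u \<longleftrightarrow>
     concat us = u \<and> (\<forall>v\<in>set us. v \<noteq> [] \<and> sorted v) \<and>
     successively (\<lambda>v v'. last v > hd v') us"

text \<open>The pair \<open>(b, j)\<close> encodes the block \<open>b^j\<close>.\<close>

definition letter_blocks :: "(nat \<times> nat) list \<Rightarrow> nat list \<Rightarrow> bool" where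
  "letter_blocks bs u \<longleftrightarrow>
     concat (map (\<lambda>(b, j). replicate j b) bs) = u \<and> (\<forall>(b, j)\<in>set bs. j > 0) \<and>
     successively (\<lambda>(b, _) (b', _). b \<noteq> b') bs"


section \<open>Eulerian polynomials and the map \<open>F\<^sub>p\<close>\<close>

definition descents :: "nat \<Rightarrow> (nat \<Rightarrow> nat) \<Rightarrow> nat" where
  "descents n \<sigma> = card {i. 1 \<le> i \<and> i < n \<and> \<sigma> i > \<sigma> (i + 1)}"

definition eulerian :: "nat \<Rightarrow> 'a::comm_ring_1 \<Rightarrow> 'a \<Rightarrow> 'a" where
  "eulerian n x y =
     (\<Sum>\<sigma> | \<sigma> permutes {1..n}. x ^ descents n \<sigma> * y ^ (n - 1 - descents n \<sigma>))"

definition eulerian_comp :: "nat list \<Rightarrow> 'k::field_char_0 poly" where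
  "eulerian_comp J =
     (\<Prod>j\<leftarrow>J. smult (1 / fact j) (poly_t * eulerian j poly_t (poly_t + 1)))"

text \<open>The linear map with \<open>t^k \<mapsto> (t + p choose k)\<close>; see the lemmas \<open>binom_map_monom\<close>,
  \<open>binom_map_add\<close> and \<open>binom_map_smult\<close>.\<close>

definition binom_map :: "int \<Rightarrow> 'k::field_char_0 poly \<Rightarrow> 'k poly" where
  "binom_map p f = (\<Sum>k\<le>degree f. smult (coeff f k) (poly_binomial (poly_t + of_int p) k))"


section \<open>Well-definedness\<close>

subsection \<open>The linear map\<close>

lemma binom_map_bound:
  assumes "degree f \<le> n"
  shows "binom_map p f = (\<Sum>k\<le>n. smult (coeff f k) (poly_binomial (poly_t + of_int p) k))"
  unfolding binom_map_def
  by (rule sum.mono_neutral_left) (use assms in \<open>auto simp: coeff_eq_0\<close>)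

lemma binom_map_add: "binom_map p (f + f') = binom_map p f + binom_map p f'"
proof -
  let ?n = "max (degree f) (degree f')"
  have "degree (f + f') \<le> ?n" by (rule degree_add_le_max)
  then show ?thesis
    by (simp add: binom_map_bound[of _ ?n] smult_add_left sum.distrib)
qed

lemma binom_map_smult: "binom_map p (smult a f) = smult a (binom_map p f)"
proof -
  have "smult a (\<Sum>k\<in>A. h k) = (\<Sum>k\<in>A. smult a (h k))" for h :: "nat \<Rightarrow> 'a poly" and A
    by (induction A rule: infinite_finite_induct) (auto simp: smult_add_right)
  then show ?thesis by (simp add: binom_map_bound[of _ "degree f"] degree_smult_le)
qed

lemma binom_map_monom: "binom_map p (poly_t ^ k) = poly_binomial (poly_t + of_int p) k"
proof -
  have *: "poly_t ^ k = (monom 1 k :: 'a poly)"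
    by (simp add: monom_altdef)
  have "binom_map p (monom (1::'a) k) =
      (\<Sum>i\<le>k. smult (coeff (monom (1::'a) k) i) (poly_binomial (poly_t + of_int p) i))"
    by (rule binom_map_bound) (simp add: degree_monom_le)
  also have "\<dots> = (\<Sum>i\<in>{k}. smult (coeff (monom (1::'a) k) i) (poly_binomial (poly_t + of_int p) i))"
    by (rule sum.mono_neutral_right) auto
  finally show ?thesis by (simp add: *)
qed


subsection \<open>Factorizations\<close>

lemma nondecreasing_runs_exist: "\<exists>us. nondecreasing_runs us u"
proof (induction u)
  case Nil
  show ?case by (rule exI[of _ "[]"]) (simp add: nondecreasing_runs_def)
next
  case (Cons a u)
  then obtain us where us: "nondecreasing_runs us u" by blast
  show ?case
  proof (cases us)
    case Nil
    then have "nondecreasing_runs [[a]] (a # u)"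
      using us by (simp add: nondecreasing_runs_def)
    then show ?thesis by blast
  next
    case (Cons v vs)
    then have v: "v \<noteq> []" "sorted v" using us by (auto simp: nondecreasing_runs_def)
    show ?thesis
    proof (cases "a \<le> hd v")
      case True
      then have "sorted (a # v)" using v by (cases v) auto
      then have "nondecreasing_runs ((a # v) # vs) (a # u)"
        using us Cons v by (cases vs) (auto simp: nondecreasing_runs_def)
      then show ?thesis by blast
    next
      case False
      then have "nondecreasing_runs ([a] # v # vs) (a # u)"
        using us Cons v by (auto simp: nondecreasing_runs_def)
      then show ?thesis by blast
    qed
  qed
qed

lemma letter_blocks_exist: "\<exists>bs. letter_blocks bs u"
proof (induction u)
  case Nil
  show ?case by (rule exI[of _ "[]"]) (simp add: letter_blocks_def)
next
  case (Cons a u)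
  then obtain bs where bs: "letter_blocks bs u" by blast
  show ?case
  proof (cases bs)
    case Nil
    then have "letter_blocks [(a, 1)] (a # u)"
      using bs by (simp add: letter_blocks_def)
    then show ?thesis by blast
  next
    case (Cons p cs)
    obtain b j where p: "p = (b, j)" by (cases p)
    show ?thesis
    proof (cases "a = b")
      case True
      then have "letter_blocks ((b, Suc j) # cs) (a # u)"
        using bs Cons p by (cases cs) (auto simp: letter_blocks_def)
      then show ?thesis by blast
    next
      case False
      then have "letter_blocks ((a, 1) # bs) (a # u)"
        using bs Cons p by (auto simp: letter_blocks_def)
      then show ?thesis by blast
    qed
  qed
qed


subsection \<open>The infinite product\<close>

lemma exp_prod_eq:
  "exp_prod n w = (if sorted w \<and> set w \<subseteq> {1..n}
     then (\<Prod>x\<in>{1..n}. 1 / fact (count_list w x)) else (0 :: 'k::field_char_0))"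
proof (induction n arbitrary: w)
  case 0
  show ?case by (simp add: ser_one_def)
next
  case (Suc n)
  let ?N = "Suc n"
  let ?t = "\<lambda>i. (exp_prod n (take i w) :: 'k) * exp_letter ?N (drop i w)"
  have nz: "sorted w \<and> set w \<subseteq> {1..?N} \<and> i = length (filter (\<lambda>x. x \<noteq> ?N) w)"
    if "?t i \<noteq> 0" "i \<le> length w" for i
  proof -
    have 1: "sorted (take i w)" "set (take i w) \<subseteq> {1..n}"
      using that(1) by (auto simp: Suc.IH split: if_splits)
    have "exp_letter ?N (drop i w) \<noteq> (0 :: 'k)" using that(1) by auto
    then obtain j where j: "drop i w = replicate j ?N"
      unfolding exp_letter_def by meson
    have w: "w = take i w @ replicate j ?N" using j by (metis append_take_drop_id)
    have "sorted (take i w @ replicate j ?N)"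
      using 1 by (fastforce simp: sorted_append)
    moreover have "set (take i w @ replicate j ?N) \<subseteq> {1..?N}"
      using 1 by fastforce
    moreover have "filter (\<lambda>x. x \<noteq> ?N) (take i w @ replicate j ?N) = take i w"
      using 1 by (fastforce simp: filter_id_conv)
    ultimately show ?thesis using w that(2) by (metis length_take min.absorb2)
  qed
  have eq: "exp_prod ?N w = (\<Sum>i\<le>length w. ?t i)"
    by (simp add: ser_mult_def)
  show ?case
  proof (cases "sorted w \<and> set w \<subseteq> {1..?N}")
    case False
    then have "?t i = 0" if "i \<le> length w" for i using nz that by blast
    then have "exp_prod ?N w = (0 :: 'k)" unfolding eq by (intro sum.neutral) auto
    then show ?thesis using False by auto
  next
    case True
    define v where "v = filter (\<lambda>x. x \<noteq> ?N) w"
    define r where "r = filter (\<lambda>x. x = ?N) w"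
    have r: "r = replicate (length r) ?N"
      by (rule replicate_eqI) (auto simp: r_def)
    have v: "sorted v" "set v \<subseteq> {1..n}"
      using True by (auto simp: v_def sorted_wrt_filter le_Suc_eq)
    have w: "w = v @ r"
    proof -
      have "sorted (v @ replicate (length r) ?N)"
        using v by (fastforce simp: sorted_append)
      then have s: "sorted (v @ r)" using r by simp
      have "mset w = mset (v @ r)"
        unfolding v_def r_def by simp
      then show "w = v @ r" using s True by (metis properties_for_sort sorted_sort_id)
    qed
    have "(\<Sum>i\<le>length w. ?t i) = (\<Sum>i\<in>{length v}. ?t i)"
      by (rule sum.mono_neutral_right) (use nz in \<open>auto simp: v_def\<close>)
    also have "\<dots> = exp_prod n v * exp_letter ?N r"
      by (simp add: w)
    also have "\<dots> = (\<Prod>x\<in>{1..n}. 1 / fact (count_list v x)) * (1 / fact (length r))"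
      using v r by (auto simp: Suc.IH exp_letter_def)
    also have "(\<Prod>x\<in>{1..n}. 1 / fact (count_list v x) :: 'k) =
        (\<Prod>x\<in>{1..n}. 1 / fact (count_list w x))"
    proof (rule prod.cong)
      fix x assume "x \<in> {1..n}"
      then have "x \<notin> set r" by (auto simp: r_def)
      then show "1 / fact (count_list v x) = (1 / fact (count_list w x) :: 'k)"
        by (simp add: w count_list_0_iff)
    qed simp
    also have "length r = count_list w ?N"
      unfolding r_def by (induction w) auto
    finally show ?thesis unfolding eq using True by simp
  qed
qed

lemma exp_prod_eventually:
  "eventually (\<lambda>n. exp_prod n w = (if sorted w \<and> 0 \<notin> set w
     then (\<Prod>x\<in>set w. 1 / fact (count_list w x)) else (0 :: 'k::field_char_0))) sequentially"
proof (rule eventually_sequentiallyI)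
  fix n assume n: "Max (insert 0 (set w)) \<le> n"
  then have le: "\<forall>x\<in>set w. x \<le> n" by simp
  have iff: "set w \<subseteq> {1..n} \<longleftrightarrow> 0 \<notin> set w"
  proof
    assume "0 \<notin> set w"
    then have "1 \<le> x" if "x \<in> set w" for x using that by (cases x) auto
    then show "set w \<subseteq> {1..n}" using le by auto
  qed auto
  show "exp_prod n w = (if sorted w \<and> 0 \<notin> set w
     then (\<Prod>x\<in>set w. 1 / fact (count_list w x)) else (0 :: 'k))"
  proof (cases "set w \<subseteq> {1..n}")
    case True
    then have "(\<Prod>x\<in>{1..n}. 1 / fact (count_list w x) :: 'k) =
        (\<Prod>x\<in>set w. 1 / fact (count_list w x))"
      by (intro prod.mono_neutral_right) (auto simp: count_list_0_iff)
    then show ?thesis using True iff by (simp add: exp_prod_eq)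
  next
    case False
    then show ?thesis using iff by (simp add: exp_prod_eq)
  qed
qed

lemma the_eventually_const:
  assumes "eventually (\<lambda>n::nat. f n = d) sequentially"
  shows "(THE c. eventually (\<lambda>n. f n = c) sequentially) = d"
proof (rule the_equality)
  show "eventually (\<lambda>n. f n = d) sequentially" by (rule assms)
  fix c assume "eventually (\<lambda>n. f n = c) sequentially"
  from eventually_conj[OF this assms] have "eventually (\<lambda>n::nat. c = d) sequentially"
    by (rule eventually_mono) (metis (no_types))
  then show "c = d" by simp
qed

lemma exp_prod_inf_eq:
  "exp_prod_inf w = (if sorted w \<and> 0 \<notin> set w
     then (\<Prod>x\<in>set w. 1 / fact (count_list w x)) else (0 :: 'k::field_char_0))"
  unfolding exp_prod_inf_def by (rule the_eventually_const[OF exp_prod_eventually])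


subsection \<open>The power \<open>g^t\<close>\<close>

lemma ser_power_eq_0:
  assumes "F [] = 0" "length w < k"
  shows "ser_power F k w = 0"
  using assms(2)
proof (induction k arbitrary: w)
  case (Suc k)
  have "F (take i w) * ser_power F k (drop i w) = 0" if "i \<le> length w" for i
  proof (cases "i = 0")
    case False
    then have "length (drop i w) < k" using Suc.prems that by (simp add: diff_less_mono)
    then show ?thesis using Suc.IH by simp
  qed (simp add: assms)
  then show ?case by (simp add: ser_mult_def)
qed simp

lemma finite_support_ser_pow_t:
  assumes "g [] = 1"
  shows "finite {k. smult (ser_power (ser_minus g ser_one) k w) (poly_binomial poly_t k) \<noteq> 0}"
proof (rule finite_subset)
  show "{k. smult (ser_power (ser_minus g ser_one) k w) (poly_binomial poly_t k) \<noteq> 0} \<subseteq> {..length w}"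
    using ser_power_eq_0[of "ser_minus g ser_one" w] assms
    by (fastforce simp: ser_minus_def ser_one_def not_less)
qed simp

lemma ser_power_map:
  assumes "\<And>v. set v \<subseteq> X \<Longrightarrow> F (map f v) = F v" "set w \<subseteq> X"
  shows "ser_power F k (map f w) = ser_power F k w"
  using assms(2)
proof (induction k arbitrary: w)
  case (Suc k)
  have "F (take i (map f w)) * ser_power F k (drop i (map f w)) =
      F (take i w) * ser_power F k (drop i w)" for i
  proof -
    have "set (take i w) \<subseteq> X" "set (drop i w) \<subseteq> X"
      using Suc.prems set_take_subset set_drop_subset by fast+
    then show ?thesis by (simp add: take_map drop_map assms(1) Suc.IH)
  qed
  then show ?case by (simp add: ser_mult_def)
qed (simp add: ser_one_def)

lemma exp_prod_inf_map:
  assumes "strict_mono_on (set w) f" "0 \<notin> set w" "0 \<notin> f ` set w"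
  shows "exp_prod_inf (map f w) = (exp_prod_inf w :: 'k::field_char_0)"
proof -
  have inj: "inj_on f (set w)"
    using assms(1) strict_mono_on_imp_inj_on by blast
  have le: "f x \<le> f y \<longleftrightarrow> x \<le> y" if "x \<in> set w" "y \<in> set w" for x y
    using strict_mono_on_less_eq[OF assms(1) that] .
  have "sorted (map f w) \<longleftrightarrow> sorted w"
    unfolding sorted_map using le by (auto intro: sorted_wrt_mono_rel[rotated])
  moreover have "(\<Prod>x\<in>f ` set w. 1 / fact (count_list (map f w) x) :: 'k) =
      (\<Prod>x\<in>set w. 1 / fact (count_list w x))"
  proof -
    have "count_list (map f w) (f x) = count_list w x" if "x \<in> set w" for x
    proof -
      have "count_list (map f v) (f x) = count_list v x" if "set v \<subseteq> set w" for v
        using that \<open>x \<in> set w\<close> inj by (induction v) (auto dest: inj_onD)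
      then show ?thesis by blast
    qed
    then show ?thesis by (simp add: prod.reindex[OF inj])
  qed
  ultimately show ?thesis using assms(2,3) by (simp add: exp_prod_inf_eq)
qed

lemma rank_less:
  assumes "finite X" "a \<in> X" "b \<in> X" "a < (b::nat)"
  shows "card {x \<in> X. x \<le> a} < card {x \<in> X. x \<le> b}"
proof (rule psubset_card_mono)
  have "b \<in> {x \<in> X. x \<le> b}" "b \<notin> {x \<in> X. x \<le> a}" using assms by auto
  moreover have "{x \<in> X. x \<le> a} \<subseteq> {x \<in> X. x \<le> b}" using assms by auto
  ultimately show "{x \<in> X. x \<le> a} \<subset> {x \<in> X. x \<le> b}" by blast
qed (use assms in simp)

lemma set_pack: "0 \<notin> set (pack w)"
  by (auto simp: pack_def)

lemma pack_map:
  assumes "strict_mono_on (set w) f"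
  shows "pack (map f w) = pack w"
proof -
  have inj: "inj_on f (set w)"
    using assms strict_mono_on_imp_inj_on by blast
  have "card {x \<in> f ` set w. x \<le> f b} = card {x \<in> set w. x \<le> b}" if "b \<in> set w" for b
  proof -
    have "{x \<in> f ` set w. x \<le> f b} = f ` {x \<in> set w. x \<le> b}"
      using strict_mono_on_less_eq[OF assms _ that] by auto
    then show ?thesis
      using inj by (simp add: card_image inj_on_subset)
  qed
  then show ?thesis by (simp add: pack_def)
qed

lemma strict_mono_pack: "strict_mono_on (set (w :: nat list)) (\<lambda>b. card {x \<in> set w. x \<le> b})"
  by (rule strict_mono_onI) (rule rank_less, auto)

lemma packed_pack: "packed (pack w)"
  unfolding packed_def using pack_map[OF strict_mono_pack, of w] by (simp only: pack_def[of w])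

lemma ser_pow_t_pack:
  assumes "is_word w"
  shows "ser_pow_t exp_prod_inf (pack w) = (ser_pow_t exp_prod_inf w :: 'k::field_char_0 poly)"
proof -
  let ?f = "\<lambda>b. card {x \<in> set w. x \<le> b}"
  let ?F = "ser_minus exp_prod_inf ser_one :: 'k series"
  have "?F (map ?f v) = ?F v" if "set v \<subseteq> set w" for v
  proof -
    have "strict_mono_on (set v) ?f"
      using strict_mono_pack[of w] that by (auto simp: strict_mono_on_def)
    moreover have "0 \<notin> set v" using assms that by (auto simp: is_word_def)
    moreover have "0 \<notin> ?f ` set v" using set_pack[of w] that by (auto simp: pack_def)
    ultimately have "exp_prod_inf (map ?f v) = (exp_prod_inf v :: 'k)"
      by (rule exp_prod_inf_map)
    then show ?thesis by (simp add: ser_minus_def ser_one_def)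
  qed
  then have "ser_power ?F k (map ?f w) = ser_power ?F k w" for k
    using ser_power_map[of "set w" ?F ?f w k] by blast
  then show ?thesis by (simp only: ser_pow_t_def pack_def[of w])
qed

lemma ser_power_not_word:
  assumes "\<And>v. \<not> is_word v \<Longrightarrow> F v = 0" "\<not> is_word w"
  shows "ser_power F k w = 0"
  using assms(2)
proof (induction k arbitrary: w)
  case 0
  then show ?case by (auto simp: ser_one_def is_word_def)
next
  case (Suc k)
  have "F (take i w) * ser_power F k (drop i w) = 0" for i
  proof -
    have "set w = set (take i w) \<union> set (drop i w)"
      by (metis append_take_drop_id set_append)
    then have "\<not> is_word (take i w) \<or> \<not> is_word (drop i w)"
      using Suc.prems by (auto simp: is_word_def)
    then show ?thesis using assms(1) Suc.IH by auto
  qed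
  then show ?case by (simp add: ser_mult_def)
qed

lemma ser_pow_t_not_word:
  assumes "\<not> is_word w"
  shows "ser_pow_t exp_prod_inf w = (0 :: 'k::field_char_0 poly)"
proof -
  have "ser_power (ser_minus exp_prod_inf ser_one) k w = (0 :: 'k)" for k
    by (rule ser_power_not_word[OF _ assms])
       (auto simp: ser_minus_def ser_one_def exp_prod_inf_eq is_word_def)
  then show ?thesis by (simp add: ser_pow_t_def)
qed

lemma M_expansion_sum:
  "Sum_any (\<lambda>u. if packed u then c u * M_series u w else 0) =
     (if is_word w then c (pack w) else 0)"
proof -
  have "Sum_any (\<lambda>u. if packed u then c u * M_series u w else 0) =
      (\<Sum>u\<in>{pack w}. if packed u then c u * M_series u w else 0)"
    by (rule Sum_any.expand_superset) (auto simp: M_series_def split: if_splits)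
  then show ?thesis by (simp add: packed_pack M_series_def)
qed

lemma M_expansion_exists:
  "\<exists>c. M_expansion (ser_pow_t exp_prod_inf :: 'k::field_char_0 poly series) c"
  by (rule exI[of _ "ser_pow_t exp_prod_inf"])
     (simp add: M_expansion_def M_expansion_sum ser_pow_t_pack ser_pow_t_not_word)

lemma M_expansion_unique:
  assumes "M_expansion G c" "packed u"
  shows "c u = G u"
proof -
  have "is_word u" using assms(2) set_pack[of u] by (simp add: packed_def is_word_def)
  moreover have "pack u = u" using assms(2) by (simp add: packed_def)
  ultimately show ?thesis using assms(1) by (simp add: M_expansion_def M_expansion_sum)
qed

end

theory Submission
  imports Defs "HOL-Combinatorics.Multiset_Permutations"
begin

text \<open>Both sides are compared at \<open>t = n\<close> for every natural number \<open>n\<close>. There \<open>c\<^sub>u(n)\<close> is the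
  coefficient of \<open>u\<close> in \<open>g\<^sup>n\<close>. If \<open>u = b\<^sup>j v\<close> and \<open>v\<close> does not start with \<open>b\<close>, then
  \<open>[u] g\<^sup>n = (\<Sum>m<n. ((m + 1)\<^sup>j - m\<^sup>j) / j! * [v] g^(n - 1 - m + \<delta>))\<close>, where \<open>\<delta> = 1\<close> if \<open>v\<close> starts with a larger
  letter and \<open>\<delta> = 0\<close> otherwise. On the other side, let \<open>L\<close> be the linear form with \<open>L(t\<^sup>k) = n choose k\<close>. Inserting the
  largest value into permutations gives \<open>B\<^sub>j\<^sub>+\<^sub>1 = t D((1 + t) B\<^sub>j)\<close> for \<open>B\<^sub>j = t E\<^sub>j(t, t + 1)\<close>, whence
  \<open>L(B\<^sub>j) = n\<^sup>j\<close>; and the Vandermonde-type identity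
  \<open>(\<Sum>m\<le>n. (m choose k) (n - m choose l)) = (n + 1 choose k + l + 1)\<close> turns products of polynomials into
  the same convolution, so that an induction over the blocks of \<open>u\<close> finishes the proof.\<close>

section \<open>Descents of lists\<close>

fun list_descents :: "'a::linorder list \<Rightarrow> nat" where
  "list_descents (x # y # zs) = of_bool (x > y) + list_descents (y # zs)"
| "list_descents _ = 0"

lemma list_descents_append:
  assumes "xs \<noteq> []" "ys \<noteq> []"
  shows "list_descents (xs @ ys) =
    list_descents xs + of_bool (last xs > hd ys) + list_descents ys"
  using assms
proof (induction xs rule: list_descents.induct)
  case ("2_2" x)
  then show ?case by (cases ys) auto
qed auto

lemma list_descents_sorted: "sorted xs \<Longrightarrow> list_descents xs = 0"
  by (induction xs rule: list_descents.induct) auto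

lemma list_descents_conv_card:
  "list_descents xs = card {i. Suc i < length xs \<and> xs ! i > xs ! Suc i}"
proof (induction xs rule: list_descents.induct)
  case (1 x y zs)
  let ?S = "\<lambda>xs. {i. Suc i < length xs \<and> (xs ! i :: 'a) > xs ! Suc i}"
  have eq: "?S (x # y # zs) = (if x > y then {0} else {}) \<union> Suc ` ?S (y # zs)"
  proof (intro set_eqI iffI)
    fix i assume "i \<in> ?S (x # y # zs)"
    then show "i \<in> (if x > y then {0} else {}) \<union> Suc ` ?S (y # zs)"
      by (cases i) auto
  qed (auto split: if_splits)
  have "finite (?S (y # zs))"
    by (rule finite_subset[of _ "{..<length (y # zs)}"]) auto
  then have "card (?S (x # y # zs)) = of_bool (x > y) + card (?S (y # zs))"
    unfolding eq by (subst card_Un_disjoint) (auto simp: card_image)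
  then show ?case using 1 by simp
qed auto

section \<open>Insertion of a new maximum into a permutation\<close>

definition insert_at :: "nat \<Rightarrow> 'a \<Rightarrow> 'a list \<Rightarrow> 'a list" where
  "insert_at i m xs = take i xs @ m # drop i xs"

text \<open>Putting \<open>m\<close> into a descent or at the end keeps the number of descents; in
  any other gap it adds one. The entry \<open>x\<close> stays in front, and \<open>f\<close> is
  arbitrary so that the comparison of \<open>x\<close> with the next entry can be absorbed into
  it.\<close>

lemma sum_list_descents_insert_tail:
  fixes f :: "nat \<Rightarrow> 'b::comm_ring_1"
  assumes "\<And>z. z \<in> set (x # ys) \<Longrightarrow> z < m"
  shows "(\<Sum>i\<le>length ys. f (list_descents (x # insert_at i m ys))) =
    of_nat (Suc (list_descents (x # ys))) * f (list_descents (x # ys)) +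
    (of_nat (length ys) - of_nat (list_descents (x # ys))) * f (Suc (list_descents (x # ys)))"
  using assms
proof (induction ys arbitrary: x f)
  case Nil
  then have "\<not> m < x" by simp
  then show ?case by (simp add: insert_at_def)
next
  case (Cons y ys)
  let ?e = "of_bool (x > y) :: nat"
  let ?d = "list_descents (y # ys)"
  have "\<not> m < x" "y < m" using Cons.prems[of x] Cons.prems[of y] by auto
  then have "(\<Sum>i\<le>length (y # ys). f (list_descents (x # insert_at i m (y # ys)))) =
      f (Suc ?d) + (\<Sum>i\<le>length ys. f (?e + list_descents (y # insert_at i m ys)))"
    by (simp add: sum.atMost_Suc_shift insert_at_def del: sum.atMost_Suc)
  also have "(\<Sum>i\<le>length ys. f (?e + list_descents (y # insert_at i m ys))) =
      of_nat (Suc ?d) * f (?e + ?d) + (of_nat (length ys) - of_nat ?d) * f (?e + Suc ?d)"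
    using Cons.IH[of y "\<lambda>d. f (?e + d)"] Cons.prems by auto
  finally show ?case by (simp add: algebra_simps)
qed

text \<open>The place in front of \<open>xs\<close>, missing from the tail version, always creates
  one more descent.\<close>

lemma sum_list_descents_insert:
  fixes f :: "nat \<Rightarrow> 'b::comm_ring_1"
  assumes "\<And>z. z \<in> set xs \<Longrightarrow> z < m" "xs \<noteq> []"
  shows "(\<Sum>i\<le>length xs. f (list_descents (insert_at i m xs))) =
    of_nat (Suc (list_descents xs)) * f (list_descents xs) +
    (of_nat (length xs) - of_nat (list_descents xs)) * f (Suc (list_descents xs))"
proof (cases xs)
  case (Cons x ys)
  have "(\<Sum>i\<le>length xs. f (list_descents (insert_at i m xs))) =
      f (Suc (list_descents xs)) + (\<Sum>i\<le>length ys. f (list_descents (x # insert_at i m ys)))"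
    using assms Cons by (simp add: sum.atMost_Suc_shift insert_at_def del: sum.atMost_Suc)
  also have "(\<Sum>i\<le>length ys. f (list_descents (x # insert_at i m ys))) =
      of_nat (Suc (list_descents xs)) * f (list_descents xs) +
      (of_nat (length ys) - of_nat (list_descents xs)) * f (Suc (list_descents xs))"
    unfolding Cons by (rule sum_list_descents_insert_tail) (use assms Cons in auto)
  finally show ?thesis
    using Cons by (simp add: algebra_simps del: sum.atMost_Suc)
qed (use assms in simp)

lemma sum_permutations_of_set_insert:
  assumes "finite A" "m \<notin> A"
  shows "(\<Sum>ys\<in>permutations_of_set (insert m A). f ys) =
    (\<Sum>xs\<in>permutations_of_set A. \<Sum>i\<le>card A. f (insert_at i m xs))"
proof -
  have len: "length xs = card A" if "xs \<in> permutations_of_set A" for xs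
    using that by (auto simp: permutations_of_set_def distinct_card)
  have notin: "m \<notin> set (take i xs)" if "xs \<in> permutations_of_set A" for xs i
    using that assms by (auto simp: permutations_of_set_def dest: in_set_takeD)
  have "(\<Sum>(xs, i)\<in>permutations_of_set A \<times> {..card A}. f (insert_at i m xs)) =
      (\<Sum>ys\<in>permutations_of_set (insert m A). f ys)"
  \<comment> \<open>The inverse map deletes \<open>m\<close> and recovers the insertion place as the
    length of the prefix before \<open>m\<close>.\<close>
  proof (rule sum.reindex_bij_witness[of _
      "\<lambda>ys. (remove1 m ys, length (takeWhile (\<lambda>x. x \<noteq> m) ys))" "\<lambda>(xs, i). insert_at i m xs"],
      goal_cases)
    case (1 p)
    then obtain xs i where p: "p = (xs, i)" "xs \<in> permutations_of_set A" "i \<le> card A" by auto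
    have "remove1 m (insert_at i m xs) = xs"
      using notin[OF p(2)] by (simp add: insert_at_def remove1_append)
    moreover have "takeWhile (\<lambda>x. x \<noteq> m) (insert_at i m xs) = take i xs"
      using notin[OF p(2), of i] unfolding insert_at_def
      by (subst takeWhile_append2) auto
    ultimately show ?case using p len by simp
  next
    case (2 p)
    then obtain xs i where p: "p = (xs, i)" "xs \<in> permutations_of_set A" "i \<le> card A" by auto
    have xs: "set xs = A" "distinct xs" using p(2) by (auto simp: permutations_of_set_def)
    have "set (take i xs) \<union> set (drop i xs) = A"
      by (metis append_take_drop_id set_append xs(1))
    moreover have "set (insert_at i m xs) = insert m (set (take i xs) \<union> set (drop i xs))"
      by (simp add: insert_at_def)
    moreover have "m \<notin> set (take i xs)" "m \<notin> set (drop i xs)"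
      using xs(1) assms(2) by (auto dest: in_set_takeD in_set_dropD)
    then have "distinct (insert_at i m xs)"
      using xs(2) set_take_disj_set_drop_if_distinct[OF xs(2) order_refl[of i]]
      by (simp add: insert_at_def)
    ultimately have "set (insert_at i m xs) = insert m A" "distinct (insert_at i m xs)"
      by (simp_all only:)
    then show ?case using p by (auto simp: permutations_of_set_def)
  next
    case (3 ys)
    then have "m \<in> set ys" by (auto simp: permutations_of_set_def)
    then obtain as bs where ys: "ys = as @ m # bs" "m \<notin> set as"
      by (meson split_list_first)
    have "takeWhile (\<lambda>x. x \<noteq> m) ys = as"
      unfolding ys using ys(2) by (subst takeWhile_append2) auto
    then show ?case using ys by (auto simp: insert_at_def remove1_append)
  next
    case (4 ys)
    then have *: "set ys = insert m A" "distinct ys" by (auto simp: permutations_of_set_def)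
    then obtain as bs where ys: "ys = as @ m # bs" "m \<notin> set as"
      by (metis insertI1 split_list_first)
    have t: "takeWhile (\<lambda>x. x \<noteq> m) ys = as"
      unfolding ys using ys(2) by (subst takeWhile_append2) auto
    have "remove1 m ys = as @ bs" using ys by (simp add: remove1_append)
    moreover have "distinct (as @ bs)" "set (as @ bs) = A"
      using * ys assms by auto
    moreover have "length as \<le> card A"
      using distinct_card[of "as @ bs"] calculation by simp
    ultimately show ?case using t by (auto simp: permutations_of_set_def)
  qed auto
  then show ?thesis by (simp add: sum.cartesian_product)
qed

text \<open>A permutation is replaced by its one-line notation; surjectivity follows from
  injectivity, since both sets have \<open>fact n\<close> elements.\<close>

lemma sum_permutes_descents:
  "(\<Sum>\<sigma> | \<sigma> permutes {1..n}. f (descents n \<sigma>)) =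
    (\<Sum>xs\<in>permutations_of_set {1..n}. f (list_descents xs))"
proof -
  let ?P = "{\<sigma>. \<sigma> permutes {1..n}}"
  let ?h = "\<lambda>\<sigma>. map \<sigma> [1..<Suc n]"
  have inj: "inj_on ?h ?P"
  proof (rule inj_onI)
    fix \<sigma> \<tau> assume *: "\<sigma> \<in> ?P" "\<tau> \<in> ?P" and eq: "?h \<sigma> = ?h \<tau>"
    have "\<sigma> x = \<tau> x" for x
    proof (cases "x \<in> {1..n}")
      case True
      then have "x \<in> set [1..<Suc n]" by auto
      then show ?thesis using eq by (meson map_eq_conv)
    qed (use * in \<open>auto simp: permutes_not_in\<close>)
    then show "\<sigma> = \<tau>" ..
  qed
  have sub: "?h ` ?P \<subseteq> permutations_of_set {1..n}"
  proof
    fix xs assume "xs \<in> ?h ` ?P"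
    then obtain \<sigma> where \<sigma>: "\<sigma> permutes {1..n}" "xs = ?h \<sigma>" by auto
    have S: "set [1..<Suc n] = {1..n}" by auto
    have "set xs = {1..n}"
      using \<sigma> S permutes_image[OF \<sigma>(1)] by (metis set_map)
    moreover have "distinct xs"
      using \<sigma> by (auto simp: distinct_map permutes_inj_on)
    ultimately show "xs \<in> permutations_of_set {1..n}" by (auto simp: permutations_of_set_def)
  qed
  have img: "?h ` ?P = permutations_of_set {1..n}"
  proof (rule card_subset_eq[OF _ sub])
    show "card (?h ` ?P) = card (permutations_of_set {1..n})"
      unfolding card_image[OF inj] by (simp add: card_permutations)
  qed simp
  have "list_descents (?h \<sigma>) = descents n \<sigma>" for \<sigma>
  proof -
    have "{i. 1 \<le> i \<and> i < n \<and> \<sigma> i > \<sigma> (i + 1)} =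
        Suc ` {i. Suc i < length (?h \<sigma>) \<and> ?h \<sigma> ! i > ?h \<sigma> ! Suc i}" (is "?A = Suc ` ?B")
    proof (intro set_eqI iffI)
      fix i assume "i \<in> ?A"
      then have "i - 1 \<in> ?B" "i = Suc (i - 1)" by (auto simp del: upt_Suc)
      then show "i \<in> Suc ` ?B" by blast
    qed (auto simp del: upt_Suc)
    then show ?thesis
      by (simp add: list_descents_conv_card descents_def card_image del: upt_Suc)
  qed
  then have "(\<Sum>\<sigma>\<in>?P. f (descents n \<sigma>)) = (\<Sum>\<sigma>\<in>?P. f (list_descents (?h \<sigma>)))"
    by simp
  also have "\<dots> = (\<Sum>xs\<in>?h ` ?P. f (list_descents xs))"
    unfolding sum.reindex[OF inj] comp_def ..
  finally show ?thesis unfolding img .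
qed

text \<open>Descents occur exactly at the boundaries between consecutive runs.\<close>

lemma length_nondecreasing_runs:
  assumes "nondecreasing_runs us u" "u \<noteq> []"
  shows "length us = Suc (list_descents u)"
  using assms
proof (induction us arbitrary: u)
  case Nil
  then show ?case by (simp add: nondecreasing_runs_def)
next
  case (Cons v vs)
  have v: "v \<noteq> []" "sorted v" "u = v @ concat vs"
    using Cons.prems by (auto simp: nondecreasing_runs_def)
  show ?case
  proof (cases vs)
    case Nil
    then show ?thesis using v by (simp add: list_descents_sorted)
  next
    case (Cons v' vs')
    then have v': "nondecreasing_runs vs (concat vs)" "v' \<noteq> []" "last v > hd v'"
      using Cons.prems by (auto simp: nondecreasing_runs_def)
    moreover have "concat vs \<noteq> []" "hd (concat vs) = hd v'" using Cons v' by auto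
    ultimately show ?thesis using v Cons.IH
      by (simp add: list_descents_append list_descents_sorted)
  qed
qed


section \<open>Evaluation at natural numbers\<close>

lemma poly_eqI_of_nat:
  fixes p q :: "'k::field_char_0 poly"
  assumes "\<And>n. poly p (of_nat n) = poly q (of_nat n)"
  shows "p = q"
proof (rule ccontr)
  assume "p \<noteq> q"
  then have "finite {x. poly (p - q) x = 0}" by (intro poly_roots_finite) simp
  moreover have "range of_nat \<subseteq> {x. poly (p - q) x = 0}" using assms by auto
  ultimately show False
    using finite_subset infinite_UNIV_nat finite_imageD[OF _ inj_of_nat] by blast
qed

text \<open>The linear form \<open>L\<close> with \<open>n\<close> as an explicit argument.\<close>

definition binom_eval :: "'k::field_char_0 poly \<Rightarrow> nat \<Rightarrow> 'k" where
  "binom_eval f n = poly (binom_map 0 f) (of_nat n)"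

lemma binom_eval_bound:
  "degree f \<le> d \<Longrightarrow> binom_eval f n = (\<Sum>k\<le>d. coeff f k * of_nat (n choose k))"
  by (simp add: binom_eval_def binom_map_bound poly_sum poly_poly_binomial binomial_gbinomial)

lemma poly_binom_map: "poly (binom_map (int p) f) (of_nat n) = binom_eval f (n + p)"
  by (simp add: binom_eval_bound[OF order_refl] binom_map_def poly_sum poly_poly_binomial
      binomial_gbinomial)

lemma binom_eval_0 [simp]: "binom_eval 0 n = 0"
  by (simp add: binom_eval_bound[OF order_refl])

lemma binom_eval_1 [simp]: "binom_eval 1 n = 1"
  by (simp add: binom_eval_bound[OF order_refl])

lemma binom_eval_add: "binom_eval (f + g) n = binom_eval f n + binom_eval g n"
  by (simp add: binom_eval_def binom_map_add)

lemma binom_eval_smult: "binom_eval (smult a f) n = a * binom_eval f n"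
  by (simp add: binom_eval_def binom_map_smult)

lemma binom_eval_sum: "binom_eval (\<Sum>x\<in>A. f x) n = (\<Sum>x\<in>A. binom_eval (f x) n)"
  by (induction A rule: infinite_finite_induct) (auto simp: binom_eval_add)

lemma binom_eval_monom: "binom_eval (monom a k) n = a * of_nat (n choose k)"
proof -
  have "binom_eval (monom a k) n = (\<Sum>i\<le>k. coeff (monom a k) i * of_nat (n choose i))"
    by (rule binom_eval_bound) (rule degree_monom_le)
  also have "\<dots> = (\<Sum>i\<in>{k}. coeff (monom a k) i * of_nat (n choose i))"
    by (rule sum.mono_neutral_right) auto
  finally show ?thesis by simp
qed

section \<open>Convolution identities and the linear form\<close>

text \<open>Both sides count the subsets of \<open>{0..n}\<close> with \<open>k + l + 1\<close>
  elements, the left one by the element \<open>m\<close> that has exactly \<open>k\<close> smaller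
  ones. The induction uses Pascal's rule in the second factor.\<close>

lemma sum_choose_mult_choose: "(\<Sum>m\<le>n. (m choose k) * (n - m choose l)) = Suc n choose Suc (k + l)"
proof (induction n arbitrary: l)
  case 0
  show ?case by (cases k; cases l) auto
next
  case (Suc n)
  show ?case
  proof (cases l)
    case 0
    then show ?thesis using Suc[of 0] by simp
  next
    case (Suc l')
    have "(\<Sum>m\<le>n. (m choose k) * (Suc n - m choose l)) =
        (\<Sum>m\<le>n. (m choose k) * (n - m choose l')) + (\<Sum>m\<le>n. (m choose k) * (n - m choose l))"
      unfolding sum.distrib[symmetric]
      by (rule sum.cong) (auto simp: Suc Suc_diff_le algebra_simps)
    then show ?thesis using Suc.IH[of l'] Suc.IH[of l] Suc by simp
  qed
qed

text \<open>The terms with \<open>n \<le> m < M\<close> vanish, since there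
  \<open>M - 1 - m < l\<close>. This slack between \<open>n\<close> and \<open>M\<close> later
  absorbs the shift by \<open>s - r\<close>.\<close>

lemma sum_choose_Suc_diff:
  assumes "n \<le> M" "M \<le> n + l"
  shows "(\<Sum>m<n. (m choose k) * (M - 1 - m choose l)) = M choose Suc (k + l)"
proof (cases M)
  case (Suc M')
  have "(\<Sum>m<n. (m choose k) * (M - 1 - m choose l)) =
      (\<Sum>m\<le>M'. (m choose k) * (M - 1 - m choose l))"
    by (rule sum.mono_neutral_left) (use assms Suc in auto)
  then show ?thesis using Suc by (simp add: sum_choose_mult_choose)
qed (use assms in simp)

text \<open>By Pascal's rule the difference takes \<open>t^(k+1)\<close> to
  \<open>m choose k\<close>, so the convolution adds exponents as multiplication does. The factor
  \<open>t^q\<close> leaves only lower indices \<ge> \<open>q\<close> in the second binomial, which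
  lets \<open>M\<close> exceed \<open>n\<close> by up to \<open>q\<close>.\<close>

lemma binom_eval_mult:
  fixes f h :: "'k::field_char_0 poly"
  assumes "n \<le> M" "M \<le> n + q"
  shows "(\<Sum>m<n. (binom_eval (poly_t * f) (Suc m) - binom_eval (poly_t * f) m) *
      binom_eval (poly_t ^ q * h) (M - 1 - m)) = binom_eval (poly_t * f * (poly_t ^ q * h)) M"
proof -
  have t: "poly_t ^ i * (\<Sum>k\<le>d. monom (a k) k) = (\<Sum>k\<le>d. monom (a k :: 'k) (i + k))" for i d a
  proof -
    have "poly_t ^ i = (monom 1 i :: 'k poly)" by (simp add: monom_altdef)
    then show ?thesis by (simp add: sum_distrib_left mult_monom)
  qed
  note mono = poly_as_sum_of_monoms
  have f: "poly_t * f = (\<Sum>k\<le>degree f. monom (coeff f k) (Suc k))"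
    using t[of 1 "coeff f" "degree f"] by (simp add: mono)
  have h: "poly_t ^ q * h = (\<Sum>l\<le>degree h. monom (coeff h l) (q + l))"
    using t[of q "coeff h" "degree h"] by (simp add: mono)
  have fd: "binom_eval (poly_t * f) (Suc m) - binom_eval (poly_t * f) m =
      (\<Sum>k\<le>degree f. coeff f k * of_nat (m choose k))" for m
    unfolding f by (simp add: binom_eval_sum binom_eval_monom algebra_simps sum.distrib)
  have "(\<Sum>m<n. (binom_eval (poly_t * f) (Suc m) - binom_eval (poly_t * f) m) *
      binom_eval (poly_t ^ q * h) (M - 1 - m)) =
      (\<Sum>m<n. \<Sum>k\<le>degree f. \<Sum>l\<le>degree h. coeff f k * coeff h l *
        of_nat ((m choose k) * (M - 1 - m choose (q + l))))"
    unfolding fd h by (simp add: binom_eval_sum binom_eval_monom sum_product mult_ac)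
  also have "\<dots> = (\<Sum>k\<le>degree f. \<Sum>l\<le>degree h. coeff f k * coeff h l *
        of_nat (\<Sum>m<n. (m choose k) * (M - 1 - m choose (q + l))))"
    by (simp add: sum_distrib_left sum.swap[of _ _ "{..<n}"])
  also have "\<dots> = (\<Sum>k\<le>degree f. \<Sum>l\<le>degree h. coeff f k * coeff h l *
        of_nat (M choose Suc (k + (q + l))))"
  proof -
    have "(\<Sum>m<n. (m choose k) * (M - 1 - m choose (q + l))) = M choose Suc (k + (q + l))" for k l
      by (rule sum_choose_Suc_diff) (use assms in auto)
    then show ?thesis by (simp only:)
  qed
  also have "\<dots> = binom_eval (poly_t * f * (poly_t ^ q * h)) M"
    unfolding f h by (simp add: sum_product mult_monom binom_eval_sum binom_eval_monom)
  finally show ?thesis .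
qed

lemma pderiv_sum: "pderiv (\<Sum>x\<in>A. f x) = (\<Sum>x\<in>A. pderiv (f x))"
  using higher_pderiv_sum[of "Suc 0" f A] by simp

text \<open>On \<open>t^k\<close> the operator gives \<open>k t^k + (k + 1) t^(k+1)\<close>, and
  \<open>k (n choose k) + (k + 1) (n choose (k + 1)) = n (n choose k)\<close>; linearity does the
  rest.\<close>

lemma binom_eval_pderiv:
  "binom_eval (poly_t * pderiv ((1 + poly_t) * f)) n = of_nat n * binom_eval f n"
proof -
  have *: "binom_eval (poly_t * pderiv ((1 + poly_t) * monom a k)) n =
      of_nat n * binom_eval (monom a k :: 'a poly) n" for a k
  proof -
    have "poly_t * pderiv ((1 + poly_t) * monom a k) =
        monom (of_nat k * a) k + monom (of_nat (Suc k) * a) (Suc k)"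
    proof -
      have "(1 + poly_t) * monom a k = monom a k + monom a (Suc k)"
        by (simp add: distrib_right monom_Suc)
      moreover have "poly_t * monom c l = monom c (Suc l)" for c :: 'a and l
        by (simp add: monom_Suc)
      ultimately show ?thesis
        by (cases k) (simp_all only: pderiv_add pderiv_monom distrib_left diff_Suc_1, simp)
    qed
    moreover have "Suc k * (n choose Suc k) = (n - k) * (n choose k)"
      by (metis binomial_absorb_comp binomial_absorption)
    then have "k * (n choose k) + Suc k * (n choose Suc k) = n * (n choose k)"
      by (cases "k \<le> n") (simp_all add: binomial_eq_0 flip: add_mult_distrib)
    then have "of_nat (k * (n choose k) + Suc k * (n choose Suc k)) =
        (of_nat (n * (n choose k)) :: 'a)" by (simp only:)
    ultimately show ?thesis
      by (simp add: binom_eval_add binom_eval_monom algebra_simps flip: distrib_left)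
  qed
  have "binom_eval (poly_t * pderiv ((1 + poly_t) * (\<Sum>k\<le>degree f. monom (coeff f k) k))) n =
     of_nat n * binom_eval (\<Sum>k\<le>degree f. monom (coeff f k) k) n"
    by (simp only: sum_distrib_left pderiv_sum binom_eval_sum *)
  then show ?thesis by (simp add: poly_as_sum_of_monoms)
qed

section \<open>Natural powers and the power \<open>g^t\<close>\<close>

text \<open>Binomial theorem for \<open>g = 1 + h\<close>. Terms beyond \<open>n\<close> vanish, so
  \<open>K\<close> is free; the induction step uses this to lower \<open>K\<close> by one in the
  factor multiplied by \<open>h\<close>.\<close>

lemma ser_power_eq_sum_binomial:
  "n \<le> K \<Longrightarrow> ser_power g n w = (\<Sum>k\<le>K. of_nat (n choose k) * ser_power (ser_minus g ser_one) k w)"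
proof (induction n arbitrary: w K)
  case 0
  then show ?case by (simp add: binomial_eq_0_iff sum.atMost_shift)
next
  case (Suc n)
  let ?h = "ser_minus g ser_one"
  obtain K' where K: "K = Suc K'" "n \<le> K'" using Suc.prems by (cases K) auto
  have "ser_power g (Suc n) w = ser_mult ?h (ser_power g n) w + ser_mult ser_one (ser_power g n) w"
    by (simp add: ser_mult_def ser_minus_def algebra_simps flip: sum.distrib)
  also have "ser_mult ser_one (ser_power g n) w =
      (\<Sum>i\<in>{0}. ser_one (take i w) * ser_power g n (drop i w))"
    unfolding ser_mult_def by (rule sum.mono_neutral_right) (auto simp: ser_one_def)
  also have "\<dots> = ser_power g n w" by (simp add: ser_one_def)
  also have "\<dots> = (\<Sum>k\<le>K. of_nat (n choose k) * ser_power ?h k w)"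
    using Suc.IH[of K] K by simp
  also have "\<dots> = ser_power ?h 0 w + (\<Sum>k\<le>K'. of_nat (n choose Suc k) * ser_power ?h (Suc k) w)"
    unfolding K(1) by (subst sum.atMost_Suc_shift) simp
  also have "ser_mult ?h (ser_power g n) w = ser_mult ?h
      (\<lambda>w. \<Sum>k\<le>K'. of_nat (n choose k) * ser_power ?h k w) w"
    using Suc.IH[of K'] K(2) by (simp add: ser_mult_def)
  also have "\<dots> = (\<Sum>k\<le>K'. of_nat (n choose k) * ser_power ?h (Suc k) w)"
    by (simp add: ser_mult_def sum_distrib_left mult_ac sum.swap[of _ "{..K'}"])
  also have "\<dots> + (ser_power ?h 0 w + (\<Sum>k\<le>K'. of_nat (n choose Suc k) * ser_power ?h (Suc k) w)) =
      ser_power ?h 0 w + (\<Sum>k\<le>K'. of_nat (Suc n choose Suc k) * ser_power ?h (Suc k) w)"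
    by (simp add: algebra_simps sum.distrib)
  also have "\<dots> = (\<Sum>k\<le>K. of_nat (Suc n choose k) * ser_power ?h k w)"
    unfolding K(1) by (subst sum.atMost_Suc_shift) simp
  finally show ?case .
qed

lemma poly_ser_pow_t:
  assumes "g [] = 1"
  shows "poly (ser_pow_t g w) (of_nat n) = ser_power g n w"
proof -
  let ?h = "ser_minus g ser_one"
  let ?T = "\<lambda>k. smult (ser_power ?h k w) (poly_binomial poly_t k)"
  \<comment> \<open>At least \<open>n\<close> for the binomial expansion, at least
    \<open>length w\<close> to contain the support of the sum defining \<open>g^t\<close>.\<close>
  let ?K = "max n (length w)"
  have zero: "ser_power ?h k w = 0" if "k > length w" for k
    by (rule ser_power_eq_0) (use assms that in \<open>auto simp: ser_minus_def ser_one_def\<close>)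
  have "ser_pow_t g w = (\<Sum>k\<le>?K. ?T k)"
    unfolding ser_pow_t_def
    by (rule Sum_any.expand_superset) (use zero in \<open>fastforce simp: not_less[symmetric]\<close>)+
  then have "poly (ser_pow_t g w) (of_nat n) =
      (\<Sum>k\<le>?K. of_nat (n choose k) * ser_power ?h k w)"
    by (simp add: poly_sum poly_poly_binomial binomial_gbinomial mult.commute)
  then show ?thesis by (simp add: ser_power_eq_sum_binomial[of n ?K])
qed

section \<open>Splitting off the leading block of a word\<close>

text \<open>The coefficient of a sorted word is the product of the inverse factorials of its
  multiplicities, and \<open>b\<close> does not occur in a sorted \<open>v\<close> that starts with
  a larger letter. An unsorted \<open>v\<close> gives 0 on both sides.\<close>

lemma exp_prod_inf_replicate_append:
  assumes "b \<noteq> 0" "v = [] \<or> b < hd v"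
  shows "exp_prod_inf (replicate j b @ v) = 1 / fact j * (exp_prod_inf v :: 'k::field_char_0)"
proof (cases "j = 0 \<or> \<not> sorted v")
  case True
  then show ?thesis by (auto simp: exp_prod_inf_eq sorted_append)
next
  case False
  then have lt: "\<forall>x\<in>set v. b < x" using assms(2) by (cases v) auto
  then have s: "sorted (replicate j b @ v)" using False by (auto simp: sorted_append less_imp_le)
  have c: "count_list (replicate j b) x = (if x = b then j else 0)" for x by (induction j) auto
  have "(\<Prod>x\<in>set (replicate j b @ v). 1 / fact (count_list (replicate j b @ v) x) :: 'k) =
      (\<Prod>x\<in>insert b (set v). 1 / fact (count_list (replicate j b @ v) x))"
    using False by (simp add: Un_commute)
  also have "\<dots> = 1 / fact j * (\<Prod>x\<in>set v. 1 / fact (count_list v x))"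
  proof -
    have "b \<notin> set v" using lt by auto
    then show ?thesis
      by (subst prod.insert)
        (auto simp: c count_list_0_iff intro!: arg_cong2[where f = "(/)"] prod.cong)
  qed
  finally show ?thesis using s False assms lt by (auto simp: exp_prod_inf_eq)
qed

text \<open>The leading factor of a factorization of \<open>b\<^sup>j v\<close> either ends inside the block \<open>b\<^sup>j\<close>
  or absorbs it completely; in the latter case it can reach into \<open>v\<close> only if \<open>v\<close> starts with a
  larger letter.\<close>

lemma ser_power_Suc_block:
  fixes v :: "nat list"
  assumes "b \<noteq> 0" "j > 0" "v = [] \<or> hd v \<noteq> b"
  defines "\<delta> \<equiv> of_bool (v \<noteq> [] \<and> b < hd v)"
  shows "ser_power exp_prod_inf (Suc n) (replicate j b @ v) =
    (\<Sum>i<j. 1 / fact i * ser_power exp_prod_inf n (replicate (j - i) b @ v)) +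
    1 / fact j * (ser_power exp_prod_inf (n + \<delta>) v :: 'k::field_char_0)"
proof -
  let ?g = "exp_prod_inf :: 'k series"
  let ?T = "\<lambda>i. ?g (take i (replicate j b @ v)) * ser_power ?g n (drop i (replicate j b @ v))"
  have g: "?g (replicate i b) = 1 / fact i" for i
    using exp_prod_inf_replicate_append[of b "[]" i] assms(1) by (simp add: exp_prod_inf_eq)
  \<comment> \<open>The index is the length of the leading factor; writing \<open>0 + j\<close>
    makes the second range fit the index shift by \<open>j\<close>.\<close>
  have "{..j + length v} = {..<j} \<union> {0 + j..length v + j}" by auto
  then have "ser_power ?g (Suc n) (replicate j b @ v) = (\<Sum>i\<in>{..<j} \<union> {0 + j..length v + j}. ?T i)"
    by (simp add: ser_mult_def)
  also have "\<dots> = (\<Sum>i<j. ?T i) + (\<Sum>i = 0 + j..length v + j. ?T i)"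
    by (rule sum.union_disjoint) auto
  also have "(\<Sum>i<j. ?T i) =
      (\<Sum>i<j. 1 / fact i * ser_power ?g n (replicate (j - i) b @ v))"
    by (rule sum.cong) (auto simp: g min_def)
  also have "(\<Sum>i = 0 + j..length v + j. ?T i) =
      (\<Sum>i\<le>length v. ?g (replicate j b @ take i v) * ser_power ?g n (drop i v))"
    unfolding sum.shift_bounds_cl_nat_ivl by (simp add: atMost_atLeast0)
  also have "\<dots> = 1 / fact j * ser_power ?g (n + \<delta>) v"
  proof (cases "v \<noteq> [] \<and> b < hd v")
    case True
    then have "?g (replicate j b @ take i v) = 1 / fact j * ?g (take i v)" for i
      by (intro exp_prod_inf_replicate_append) (use assms True in \<open>auto simp: take_Cons' neq_Nil_conv\<close>)
    \<comment> \<open>Summing over the prefixes of \<open>v\<close> is again multiplication by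
      \<open>?g\<close>, hence one more power.\<close>
    then show ?thesis
      using True by (simp add: \<delta>_def ser_mult_def sum_distrib_left mult_ac)
  next
    case False
    have "?g (replicate j b @ take i v) = 0" if "i \<noteq> 0" "i \<le> length v" for i
    proof -
      have "v \<noteq> []" using that by auto
      then have "hd v \<in> set (take i v)" using that by (cases v; cases i) auto
      moreover have "hd v < b" using \<open>v \<noteq> []\<close> False assms(3) by auto
      ultimately have "\<not> sorted (replicate j b @ take i v)"
        using assms(2) by (auto simp: sorted_append not_le)
      then show ?thesis by (simp add: exp_prod_inf_eq)
    qed
    then have "(\<Sum>i\<le>length v. ?g (replicate j b @ take i v) * ser_power ?g n (drop i v)) =
        (\<Sum>i\<in>{0}. ?g (replicate j b @ take i v) * ser_power ?g n (drop i v))"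
      by (intro sum.mono_neutral_right) auto
    moreover have "\<delta> = 0" using False by (auto simp: \<delta>_def)
    ultimately show ?thesis by (simp add: g)
  qed
  finally show ?thesis .
qed

text \<open>Here \<open>m + 1\<close> is the position of the last of the \<open>n\<close> factors
  that meets the block. As the coefficient of \<open>b^j\<close> in \<open>g^m\<close> is
  \<open>m^j / j!\<close>, the difference weighs the distributions of the block over the first
  \<open>m + 1\<close> factors with the last one used. The \<open>n - 1 - m\<close> later factors
  remain for \<open>v\<close>, and that last one too if \<open>\<delta> = 1\<close>.\<close>

lemma ser_power_block:
  fixes v :: "nat list"
  assumes "b \<noteq> 0" "j > 0" "v = [] \<or> hd v \<noteq> b"
  defines "\<delta> \<equiv> of_bool (v \<noteq> [] \<and> b < hd v)"
  shows "ser_power exp_prod_inf n (replicate j b @ v) =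
    (\<Sum>m<n. (of_nat (Suc m) ^ j - of_nat m ^ j) / fact j *
      (ser_power exp_prod_inf (n - 1 - m + \<delta>) v :: 'k::field_char_0))"
  using assms(2)
proof (induction n arbitrary: j)
  case 0
  then show ?case by (auto simp: ser_one_def)
next
  case (Suc n)
  let ?p = "\<lambda>n. ser_power exp_prod_inf n v :: 'k"
  let ?d = "\<lambda>j m. of_nat (Suc m) ^ j - of_nat m ^ j :: 'k"
  \<comment> \<open>The coefficient of \<open>x^j\<close> in
    \<open>e^x (e^((m+1)x) - e^(mx)) = e^((m+2)x) - e^((m+1)x)\<close>; the term
    \<open>i = j\<close> would be 0.\<close>
  have *: "(\<Sum>i<j. 1 / fact i * (?d (j - i) m / fact (j - i))) = ?d j (Suc m) / fact j" for m
  proof -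
    have pow: "(x + 1) ^ j = (\<Sum>i\<le>j. of_nat (j choose i) * x ^ (j - i))" for x :: 'k
      using binomial_ring[of 1 x j] by (simp add: add.commute)
    have "?d j (Suc m) = (\<Sum>i\<le>j. of_nat (j choose i) * ?d (j - i) m)"
      using pow[of "of_nat (Suc m)"] pow[of "of_nat m"]
      by (simp add: add.commute right_diff_distrib sum_subtractf)
    also have "\<dots> = (\<Sum>i<j. of_nat (j choose i) * ?d (j - i) m)"
      by (rule sum.mono_neutral_right) (auto simp: not_less)
    also have "\<dots> = (\<Sum>i<j. fact j * (1 / fact i * (?d (j - i) m / fact (j - i))))"
      by (rule sum.cong) (auto simp: binomial_fact)
    finally show ?thesis by (simp only: sum_distrib_left[symmetric]) simp
  qed
  have "ser_power exp_prod_inf (Suc n) (replicate j b @ v) =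
      (\<Sum>i<j. 1 / fact i * (\<Sum>m<n. ?d (j - i) m / fact (j - i) * ?p (n - 1 - m + \<delta>))) +
      1 / fact j * ?p (n + \<delta>)"
    using Suc.IH by (subst ser_power_Suc_block) (use assms Suc.prems in auto)
  also have "(\<Sum>i<j. 1 / fact i * (\<Sum>m<n. ?d (j - i) m / fact (j - i) * ?p (n - 1 - m + \<delta>))) =
      (\<Sum>m<n. (\<Sum>i<j. 1 / fact i * (?d (j - i) m / fact (j - i))) * ?p (n - 1 - m + \<delta>))"
    unfolding sum_distrib_left sum_distrib_right by (subst sum.swap) (simp add: mult_ac)
  \<comment> \<open>The separate summand becomes the term \<open>m = 0\<close>, because
    \<open>0 ^ j = 0\<close> for \<open>j > 0\<close>.\<close>
  also have "\<dots> + 1 / fact j * ?p (n + \<delta>) =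
      (\<Sum>m<Suc n. ?d j m / fact j * ?p (Suc n - 1 - m + \<delta>))"
    unfolding * using Suc.prems by (subst sum.lessThan_Suc_shift) simp
  finally show ?case .
qed


section \<open>Eulerian polynomials\<close>

text \<open>With \<open>d\<close> descents, \<open>d + 1\<close> insertion places keep
  \<open>d\<close> and \<open>n + 1 - d\<close> raise it; these are the two coefficients in the
  product rule for \<open>t^(d+1) (1+t)^(n+1-d)\<close>.\<close>

lemma eulerian_Suc_pderiv:
  "poly_t * eulerian (Suc (Suc n)) poly_t (poly_t + 1) =
    poly_t * pderiv ((1 + poly_t) *
      (poly_t * eulerian (Suc n) poly_t (poly_t + 1 :: 'k::field_char_0 poly)))"
proof -
  let ?t = "poly_t :: 'k poly"
  let ?P = "permutations_of_set {1..Suc n}"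
  \<comment> \<open>The weight on the left-hand side of a permutation of \<open>n + 2\<close> values
    with \<open>d\<close> descents.\<close>
  define F where "F d = ?t ^ Suc d * (?t + 1) ^ (Suc n - d)" for d
  have eul: "?t * eulerian m ?t (?t + 1) =
      (\<Sum>xs\<in>permutations_of_set {1..m}. ?t ^ Suc (list_descents xs) *
        (?t + 1) ^ (m - 1 - list_descents xs))" for m
    unfolding eulerian_def sum_permutes_descents[where f = "\<lambda>d. ?t ^ d * (?t + 1) ^ (m - 1 - d)"]
    by (simp add: sum_distrib_left mult.assoc)
  have step: "(\<Sum>i\<le>Suc n. F (list_descents (insert_at i (Suc (Suc n)) xs))) =
      ?t * pderiv ((1 + ?t) * (?t ^ Suc (list_descents xs) * (?t + 1) ^ (n - list_descents xs)))"
    if xs: "xs \<in> ?P" for xs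
  proof -
    let ?d = "list_descents xs"
    have len: "length xs = Suc n" "xs \<noteq> []"
      using xs length_finite_permutations_of_set[of xs "{1..Suc n}"] by auto
    \<comment> \<open>The bound \<open>?d \<le> n\<close> makes the truncated subtractions exact and
      allows a factor \<open>1 + t\<close> to be split off.\<close>
    have "{i. Suc i < length xs \<and> xs ! i > xs ! Suc i} \<subseteq> {..<n}" using len by auto
    from card_mono[OF _ this] have d: "?d \<le> n" by (simp add: list_descents_conv_card)
    have "(\<Sum>i\<le>length xs. F (list_descents (insert_at i (Suc (Suc n)) xs))) =
        of_nat (Suc ?d) * F ?d + (of_nat (length xs) - of_nat ?d) * F (Suc ?d)"
      by (rule sum_list_descents_insert) (use xs len in \<open>auto simp: permutations_of_set_def\<close>)
    also have "of_nat (length xs) - of_nat ?d = (of_nat (Suc n - ?d) :: 'k poly)"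
      using d len by (simp add: of_nat_diff)
    also have "of_nat (Suc ?d) * F ?d + of_nat (Suc n - ?d) * F (Suc ?d) =
        ?t * pderiv (?t ^ Suc ?d * (?t + 1) ^ (Suc n - ?d))"
    proof -
      have pd: "pderiv ?t = 1" "pderiv (?t + 1) = 1" by (simp_all add: pderiv_pCons pderiv_add)
      have "pderiv (?t ^ Suc ?d) = of_nat (Suc ?d) * ?t ^ ?d"
        "pderiv ((?t + 1) ^ (Suc n - ?d)) = of_nat (Suc n - ?d) * (?t + 1) ^ (n - ?d)"
        unfolding pderiv_power pd by (simp_all add: of_nat_poly)
      then show ?thesis unfolding pderiv_mult F_def by (simp only: diff_Suc_Suc) (simp only: algebra_simps power_Suc)
    qed
    also have "?t ^ Suc ?d * (?t + 1) ^ (Suc n - ?d) =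
        (1 + ?t) * (?t ^ Suc ?d * (?t + 1) ^ (n - ?d))"
      unfolding Suc_diff_le[OF d] by (simp only: power_Suc mult_ac add.commute)
    finally show ?thesis unfolding len .
  qed
  have "?t * eulerian (Suc (Suc n)) ?t (?t + 1) =
      (\<Sum>ys\<in>permutations_of_set (insert (Suc (Suc n)) {1..Suc n}). F (list_descents ys))"
  proof -
    have "insert (Suc (Suc n)) {1..Suc n} = {1..Suc (Suc n)}" by auto
    then show ?thesis unfolding eul F_def by (simp only: diff_Suc_1)
  qed
  also have "\<dots> = (\<Sum>xs\<in>?P. \<Sum>i\<le>Suc n. F (list_descents (insert_at i (Suc (Suc n)) xs)))"
    by (subst sum_permutations_of_set_insert) auto
  also have "\<dots> = (\<Sum>xs\<in>?P. ?t * pderiv ((1 + ?t) *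
      (?t ^ Suc (list_descents xs) * (?t + 1) ^ (n - list_descents xs))))"
    using step by (rule sum.cong[OF refl])
  also have "\<dots> = ?t * pderiv ((1 + ?t) * (?t * eulerian (Suc n) ?t (?t + 1)))"
    unfolding eul by (simp add: sum_distrib_left pderiv_sum)
  finally show ?thesis .
qed

text \<open>Starting from \<open>L(t) = m\<close>, each insertion step multiplies the value by
  \<open>m\<close>.\<close>

lemma binom_eval_eulerian:
  "binom_eval (poly_t * eulerian (Suc n) poly_t (poly_t + 1)) m = (of_nat m ^ Suc n :: 'k::field_char_0)"
proof (induction n)
  case 0
  have "eulerian (Suc 0) poly_t (poly_t + 1) = (1 :: 'k poly)"
    by (simp add: eulerian_def descents_def)
  then show ?case using binom_eval_monom[of "1 :: 'k" 1 m] by (simp add: monom_altdef)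
next
  case (Suc n)
  then show ?case by (simp only: eulerian_Suc_pderiv binom_eval_pderiv power_Suc)
qed

section \<open>Induction over the blocks\<close>

text \<open>Each block contributes a factor \<open>t\<close>; this supplies the exponent
  \<open>q\<close> for \<open>binom_eval_mult\<close>.\<close>

lemma eulerian_comp_eq_power_mult:
  "\<exists>h. eulerian_comp J = poly_t ^ length J * (h :: 'k::field_char_0 poly)"
proof (induction J)
  case Nil
  show ?case by (rule exI[of _ 1]) (simp add: eulerian_comp_def)
next
  case (Cons j J)
  then obtain h where h: "eulerian_comp J = poly_t ^ length J * (h :: 'k poly)" by blast
  have "eulerian_comp (j # J) =
      smult (1 / fact j) (poly_t * eulerian j poly_t (poly_t + 1)) * (eulerian_comp J :: 'k poly)"
    by (simp add: eulerian_comp_def)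
  also have "\<dots> = poly_t ^ length (j # J) * (smult (1 / fact j) (eulerian j poly_t (poly_t + 1)) * h)"
    unfolding h by (simp add: mult_ac)
  finally show ?case by blast
qed

text \<open>Setting \<open>r = 0\<close> for the empty word makes the empty block list a valid base
  case. The bound on \<open>r\<close> is carried along to keep the natural subtraction
  exact.\<close>

lemma ser_power_letter_blocks:
  assumes "letter_blocks bs u" "0 \<notin> set u"
  defines "r \<equiv> if u = [] then 0 else Suc (list_descents u)"
  shows "r \<le> length bs \<and> (\<forall>n. ser_power exp_prod_inf n u =
    (binom_eval (eulerian_comp (map snd bs)) (n + (length bs - r)) :: 'k::field_char_0))"
  using assms(1,2) unfolding r_def
proof (induction bs arbitrary: u)
  case Nil
  have "ser_power exp_prod_inf n [] = (1 :: 'k)" for n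
    by (induction n) (simp_all add: ser_one_def ser_mult_def exp_prod_inf_eq)
  then show ?case using Nil by (simp add: letter_blocks_def eulerian_comp_def)
next
  case (Cons p bs)
  obtain b j where p: "p = (b, j)" by (cases p)
  define R :: "nat list \<Rightarrow> nat" where "R u = (if u = [] then 0 else Suc (list_descents u))" for u
  define v where "v = concat (map (\<lambda>(b, j). replicate j b) bs)"
  have bs: "letter_blocks bs v" and j: "j > 0" and u: "u = replicate j b @ v"
    using Cons.prems(1) unfolding p letter_blocks_def v_def
    by (auto simp: successively_Cons)
  have b: "b \<noteq> 0" and v0: "0 \<notin> set v" using Cons.prems(2) j unfolding u by auto
  have hd: "v = [] \<or> hd v \<noteq> b"
  proof (cases bs)
    case Nil
    then show ?thesis by (simp add: v_def)
  next
    case (Cons q bs')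
    then show ?thesis using Cons.prems(1) unfolding p letter_blocks_def v_def
      by (cases q) auto
  qed
  define \<delta> :: nat where "\<delta> = of_bool (v \<noteq> [] \<and> b < hd v)"
  have IH: "R v \<le> length bs" "\<And>n. ser_power exp_prod_inf n v =
      (binom_eval (eulerian_comp (map snd bs)) (n + (length bs - R v)) :: 'k)"
    using Cons.IH[OF bs v0] unfolding R_def by blast+
  \<comment> \<open>A new leading block joins the first run of \<open>v\<close> exactly when
    \<open>\<delta> = 1\<close>; otherwise it is a run of its own.\<close>
  have r: "R u + \<delta> = Suc (R v)"
  proof (cases "v = []")
    case False
    have "sorted (replicate j b)" by (simp add: sorted_replicate)
    then show ?thesis using hd j False unfolding u \<delta>_def R_def
      by (simp add: list_descents_append list_descents_sorted)
  qed (use j in \<open>simp add: u \<delta>_def R_def list_descents_sorted\<close>)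
  have \<delta>: "\<delta> \<le> R v" by (simp add: \<delta>_def R_def)
  let ?e = "eulerian_comp (map snd bs) :: 'k poly"
  obtain h where h: "?e = poly_t ^ length bs * h"
    using eulerian_comp_eq_power_mult[of "map snd bs"] by auto
  define f where "f = smult (1 / fact j) (eulerian j poly_t (poly_t + 1) :: 'k poly)"
  have f: "binom_eval (poly_t * f) m = of_nat m ^ j / fact j" for m
    using j binom_eval_eulerian[of "j - 1" m, where 'k = 'k]
    unfolding f_def mult_smult_right binom_eval_smult by simp
  have e: "eulerian_comp (map snd (p # bs)) = poly_t * f * ?e"
    by (simp add: p f_def eulerian_comp_def)
  have "ser_power exp_prod_inf n u = binom_eval (poly_t * f * ?e) (n + (length (p # bs) - R u))" for n
  proof -
    let ?M = "n + (length (p # bs) - R u)"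
    \<comment> \<open>Blocks grow by 1 and runs by \<open>1 - \<delta>\<close>, so the shift grows
      by the same \<open>\<delta>\<close> that \<open>ser_power_block\<close> adds to the
      power.\<close>
    have M: "?M = n + \<delta> + (length bs - R v)" using r IH(1) \<delta> unfolding length_Cons by linarith
    have "ser_power exp_prod_inf n u =
        (\<Sum>m<n. (binom_eval (poly_t * f) (Suc m) - binom_eval (poly_t * f) m) *
          binom_eval ?e (?M - 1 - m))"
    proof -
      have "ser_power exp_prod_inf n u = (\<Sum>m<n. (of_nat (Suc m) ^ j - of_nat m ^ j) / fact j *
          (ser_power exp_prod_inf (n - 1 - m + \<delta>) v :: 'k))"
        unfolding u \<delta>_def by (rule ser_power_block[OF b j hd])
      also have "\<dots> = (\<Sum>m<n. (binom_eval (poly_t * f) (Suc m) - binom_eval (poly_t * f) m) *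
          binom_eval ?e (?M - 1 - m))"
      proof (rule sum.cong[OF refl])
        fix m assume "m \<in> {..<n}"
        then have "n - 1 - m + \<delta> + (length bs - R v) = ?M - 1 - m"
          unfolding M by simp
        then show "(of_nat (Suc m) ^ j - of_nat m ^ j) / fact j *
            ser_power exp_prod_inf (n - 1 - m + \<delta>) v =
            (binom_eval (poly_t * f) (Suc m) - binom_eval (poly_t * f) m) * binom_eval ?e (?M - 1 - m)"
          unfolding IH(2) f by (simp only: diff_divide_distrib)
      qed
      finally show ?thesis .
    qed
    also have "\<dots> = binom_eval (poly_t * f * ?e) ?M"
      \<comment> \<open>The condition \<open>?M \<le> n + length bs\<close> amounts to
        \<open>\<delta> \<le> R v\<close>.\<close>
      unfolding h by (rule binom_eval_mult) (use M IH(1) \<delta> in linarith)+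
    finally show ?thesis .
  qed
  moreover have "R u \<le> length (p # bs)" using r IH(1) by simp
  ultimately show ?case unfolding e R_def by blast
qed

theorem theorem9p1:
  fixes c :: "nat list \<Rightarrow> 'k::field_char_0 poly"
    and u :: "nat list" and us :: "nat list list" and bs :: "(nat \<times> nat) list"
    and I J :: "nat list" and r s :: nat
  assumes "M_expansion (ser_pow_t exp_prod_inf) c"
    and "packed u" and "u \<noteq> []"
    and "nondecreasing_runs us u" and "I = map length us"
    and "letter_blocks bs u" and "J = map snd bs"
    and "r = length I" and "s = length J"
  shows "c u = binom_map (int s - int r) (eulerian_comp J)"
proof (rule poly_eqI_of_nat)
  fix n
  have "0 \<notin> set u" using assms(2) set_pack[of u] by (simp add: packed_def)
  note blocks = ser_power_letter_blocks[OF assms(6) this, where 'k = 'k]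
  have r: "r = Suc (list_descents u)"
    using length_nondecreasing_runs[OF assms(4,3)] assms by simp
  \<comment> \<open>This turns the integer shift \<open>int s - int r\<close> into a natural
    number.\<close>
  then have "r \<le> s" using blocks assms by simp
  then have "poly (binom_map (int s - int r) (eulerian_comp J)) (of_nat n) =
      (binom_eval (eulerian_comp J) (n + (s - r)) :: 'k)"
    by (simp add: poly_binom_map flip: of_nat_diff)
  also have "\<dots> = ser_power exp_prod_inf n u"
    using blocks assms r by simp
  also have "\<dots> = poly (ser_pow_t exp_prod_inf u) (of_nat n)"
    by (rule poly_ser_pow_t[symmetric]) (simp add: exp_prod_inf_eq)
  finally show "poly (c u) (of_nat n) = poly (binom_map (int s - int r) (eulerian_comp J)) (of_nat n)"
    using M_expansion_unique[OF assms(1,2)] by simp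
qed

end
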